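(* Let $n\ge1$ be an integer, and let $\alpha=(\alpha_1,\ldots,\alpha_{n+1})$ and $\beta=(\beta_1,\ldots,\beta_{n+1})$ with $\alpha_i>0$ and $\beta_i>0$ for all $i$. Let $G_{\alpha,\beta}$ be the multivariate Gamma distribution on $(\mathbb{R}_+^* )^{n+1}$, let $H_{n+1}:(\mathbb{R}_+^* )^{n+1}\to C_n$ be the homogeneous transform, and let $\mu_{C_n}$ be the reference measure on $C_n$ (all defined in the context). Then $(H_{n+1})_*G_{\alpha,\beta}$ is absolutely continuous with respect to $\mu_{C_n}$, and its Radon-Nikodým derivative is $$\frac{d\big((H_{n+1})_*G_{\alpha,\beta}\big)}{d\mu_{C_n}}=g_{\alpha,\beta},$$ where $g_{\alpha,\beta}:C_n\to\mathbb{R}$ is the function such that, for all $(x_1,\ldots,x_n)\in B_n$, $$(g_{\alpha,\beta}\circ\mathcal{C}_n)(x_1,\ldots,x_n)=\frac{1}{\sqrt{n+1}}\,\frac{D_\alpha(x_1,\ldots,x_n)}{\mathrm{B}(\alpha_1,\ldots,\alpha_{n+1})}\,\frac{\beta_1^{\alpha_1}\cdots\beta_{n+1}^{\alpha_{n+1}}}{\left[\beta_1x_1+\cdots+\beta_nx_n+\beta_{n+1}\left(1-\sum_{i=1}^n x_i\right)\right]^{\alpha_1+\cdots+\alpha_{n+1}}}.$$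
   Context: $\mathbb{R}_+^*=\,]0,+\infty[$, and $\lambda_{\mathbb{R}^m}$ is Lebesgue measure on $\mathbb{R}^m$ (or its restriction to a Borel subset). All measures are on Borel $\sigma$-algebras, and the pushforward is $\Phi_*\mu(E)=\mu(\Phi^{-1}(E))$. $B_n=\{(x_1,\ldots,x_n)\in\,]0,1[^n : \sum_{i=1}^n x_i<1\}$. $C_n=\{(y_1,\ldots,y_{n+1})\in\mathbb{R}^{n+1}: 0<y_i<1 \text{ for all } i,\ \sum_{i=1}^{n+1}y_i=1\}$. $\mathcal{C}_n:B_n\to C_n$ is the bijection $\mathcal{C}_n(x_1,\ldots,x_n)=(x_1,\ldots,x_n,1-\sum_{i=1}^n x_i)$. The measure $\mu_{C_n}$ on $C_n$ is $\mu_{C_n}=(\mathcal{C}_n)_*\big(\sqrt{n+1}\,\lambda_{\mathbb{R}^n}|_{B_n}\big)$ (the surface measure on $C_n$). The homogeneous transform is $H_{n+1}:(\mathbb{R}_+^* )^{n+1}\to C_n$, $H_{n+1}(y_1,\ldots,y_{n+1})=\left(\frac{y_1}{\sum_{i=1}^{n+1}y_i},\ldots,\frac{y_{n+1}}{\sum_{i=1}^{n+1}y_i}\right)$. For $\alpha_1,\ldots,\alpha_{n+1}>0$, $D_\alpha:B_n\to\mathbb{R}$ is $D_\alpha(x_1,\ldots,x_n)=\left(\prod_{i=1}^n x_i^{\alpha_i-1}\right)\left(1-\sum_{i=1}^n x_i\right)^{\alpha_{n+1}-1}$, and the multivariate Beta function is $\mathrm{B}(\alpha_1,\ldots,\alpha_{n+1})=\int_{B_n}D_\alpha(x_1,\ldots,x_n)\,dx_1\cdots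 dx_n$. With $\Gamma$ the Euler Gamma function, for $a,b>0$ let $\gamma_{a,b}(x)=\frac{1}{\Gamma(a)}b^a x^{a-1}e^{-bx}$ for $x>0$. The multivariate Gamma distribution is $G_{\alpha,\beta}=f_{\alpha,\beta}\,\lambda_{\mathbb{R}^{n+1}}$ on $(\mathbb{R}_+^* )^{n+1}$, with $f_{\alpha,\beta}(y_1,\ldots,y_{n+1})=\prod_{i=1}^{n+1}\gamma_{\alpha_i,\beta_i}(y_i)$. *)

theory Defs
  imports "HOL-Analysis.Analysis"
begin

text \<open>
  A point of \<open>\<real>\<^sup>n\<close> is an extensional function on the index set \<open>{1..n}\<close>. The product
  \<open>\<sigma>\<close>-algebra below is the Borel \<open>\<sigma>\<close>-algebra of \<open>\<real>\<^sup>n\<close>, and the product measure is Lebesgue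
  measure on it. Only \<open>\<alpha> i\<close>, \<open>\<beta> i\<close> with \<open>1 \<le> i \<le> n + 1\<close> are ever used.
\<close>

definition lborel_pow :: "nat \<Rightarrow> (nat \<Rightarrow> real) measure" where
  "lborel_pow n = (\<Pi>\<^sub>M i\<in>{1..n}. lborel)"

definition pos_orthant :: "nat \<Rightarrow> (nat \<Rightarrow> real) set" where
  "pos_orthant n = {1..n} \<rightarrow>\<^sub>E {0<..}"

definition B_set :: "nat \<Rightarrow> (nat \<Rightarrow> real) set" where
  "B_set n = {x \<in> {1..n} \<rightarrow>\<^sub>E {0<..<1}. (\<Sum>i=1..n. x i) < 1}"

definition C_set :: "nat \<Rightarrow> (nat \<Rightarrow> real) set" where
  "C_set n = {y \<in> {1..n+1} \<rightarrow>\<^sub>E {0<..<1}. (\<Sum>i=1..n+1. y i) = 1}"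

definition C_map :: "nat \<Rightarrow> (nat \<Rightarrow> real) \<Rightarrow> (nat \<Rightarrow> real)" where
  "C_map n x = x(n+1 := 1 - (\<Sum>i=1..n. x i))"

text \<open>The Borel space underlying \<open>C_set n\<close>; only its \<open>\<sigma>\<close>-algebra is used.\<close>

definition C_borel :: "nat \<Rightarrow> (nat \<Rightarrow> real) measure" where
  "C_borel n = restrict_space (\<Pi>\<^sub>M i\<in>{1..n+1}. borel) (C_set n)"

definition mu_C :: "nat \<Rightarrow> (nat \<Rightarrow> real) measure" where
  "mu_C n = distr (scale_measure (ennreal (sqrt (real n + 1))) (restrict_space (lborel_pow n) (B_set n)))
                  (C_borel n) (C_map n)"

text \<open>\<open>H_map n\<close> is the homogeneous transform \<open>H\<close> of index \<open>n + 1\<close>, with values in \<open>C_set n\<close>.\<close>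

definition H_map :: "nat \<Rightarrow> (nat \<Rightarrow> real) \<Rightarrow> (nat \<Rightarrow> real)" where
  "H_map n y = (\<lambda>i\<in>{1..n+1}. y i / (\<Sum>j=1..n+1. y j))"

definition D_fun :: "nat \<Rightarrow> (nat \<Rightarrow> real) \<Rightarrow> (nat \<Rightarrow> real) \<Rightarrow> real" where
  "D_fun n \<alpha> x = (\<Prod>i=1..n. x i powr (\<alpha> i - 1)) * (1 - (\<Sum>i=1..n. x i)) powr (\<alpha> (n+1) - 1)"

definition multi_Beta :: "nat \<Rightarrow> (nat \<Rightarrow> real) \<Rightarrow> real" where
  "multi_Beta n \<alpha> = (LINT x:B_set n|lborel_pow n. D_fun n \<alpha> x)"

text \<open>Meant for \<open>x > 0\<close> only.\<close>

definition gamma_density :: "real \<Rightarrow> real \<Rightarrow> real \<Rightarrow> real" where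
  "gamma_density a b x = 1 / Gamma a * b powr a * x powr (a - 1) * exp (- b * x)"

definition multi_Gamma :: "nat \<Rightarrow> (nat \<Rightarrow> real) \<Rightarrow> (nat \<Rightarrow> real) \<Rightarrow> (nat \<Rightarrow> real) measure" where
  "multi_Gamma n \<alpha> \<beta> = density (restrict_space (lborel_pow (n+1)) (pos_orthant (n+1)))
     (\<lambda>y. ennreal (\<Prod>i=1..n+1. gamma_density (\<alpha> i) (\<beta> i) (y i)))"

text \<open>Hence a function on \<open>C_set n\<close> is determined by, and can be prescribed through, its
  composition with \<open>C_map n\<close>. For \<open>n = 0\<close> the set \<open>C_set n\<close> is empty while \<open>B_set n\<close> is not.\<close>

lemma bij_betw_C_map:
  assumes n: "1 \<le> n"
  shows "bij_betw (C_map n) (B_set n) (C_set n)"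
proof (rule bij_betw_byWitness[where f' = "\<lambda>y. restrict y {1..n}"])
  have split: "(\<Sum>i=1..n+1. y i) = (\<Sum>i=1..n. y i) + y (n+1)" for y :: "nat \<Rightarrow> real"
    by simp
  show "\<forall>x\<in>B_set n. restrict (C_map n x) {1..n} = x"
    by (auto simp: B_set_def C_map_def fun_eq_iff PiE_def extensional_def)
  show "\<forall>y\<in>C_set n. C_map n (restrict y {1..n}) = y"
    unfolding C_set_def C_map_def
    by (auto simp: fun_eq_iff PiE_def extensional_def)
  show "C_map n ` B_set n \<subseteq> C_set n"
  proof (rule image_subsetI)
    fix x assume x: "x \<in> B_set n"
    have pos: "0 < (\<Sum>i=1..n. x i)"
      using x n by (intro sum_pos) (auto simp: B_set_def PiE_def Pi_def)
    have "C_map n x \<in> {1..n+1} \<rightarrow>\<^sub>E {0<..<1}"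
      using x pos by (auto simp: B_set_def C_map_def PiE_iff extensional_def le_Suc_eq)
    moreover have "(\<Sum>i=1..n. C_map n x i) = (\<Sum>i=1..n. x i)"
      by (rule sum.cong) (auto simp: C_map_def)
    ultimately show "C_map n x \<in> C_set n"
      unfolding C_set_def split by (simp add: C_map_def)
  qed
  show "(\<lambda>y. restrict y {1..n}) ` C_set n \<subseteq> B_set n"
  proof (rule image_subsetI)
    fix y assume y: "y \<in> C_set n"
    then have "0 < y (n+1)" and "(\<Sum>i=1..n. y i) + y (n+1) = 1"
      unfolding C_set_def split by (auto simp: PiE_iff)
    then have "(\<Sum>i=1..n. y i) < 1" by linarith
    then show "restrict y {1..n} \<in> B_set n"
      using y by (auto simp: C_set_def B_set_def PiE_iff)
  qed
qed

text \<open>The pushforwards along \<open>C_map n\<close> and \<open>H_map n\<close> are genuine ones: both maps are measurable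
  into \<open>C_borel n\<close>.\<close>

lemma measurable_C_map:
  assumes n: "1 \<le> n"
  shows "C_map n \<in> restrict_space (lborel_pow n) (B_set n) \<rightarrow>\<^sub>M C_borel n"
  unfolding C_borel_def
proof (rule measurable_restrict_space2)
  show "C_map n \<in> space (restrict_space (lborel_pow n) (B_set n)) \<rightarrow> C_set n"
    using bij_betw_C_map[OF n] by (auto simp: space_restrict_space bij_betw_def)
  have "C_map n \<in> lborel_pow n \<rightarrow>\<^sub>M (\<Pi>\<^sub>M i\<in>{1..n+1}. borel)"
  proof (rule measurable_PiM_single')
    fix i assume i: "i \<in> {1..n+1}"
    show "(\<lambda>x. C_map n x i) \<in> borel_measurable (lborel_pow n)"
    proof (cases "i = n+1")
      case True
      have "(\<lambda>x. 1 - (\<Sum>i=1..n. x i)) \<in> borel_measurable (lborel_pow n)"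
        unfolding lborel_pow_def by measurable
      then show ?thesis using True by (simp add: C_map_def)
    next
      case False
      then have "i \<in> {1..n}" using i by auto
      then have "(\<lambda>x. x i) \<in> borel_measurable (lborel_pow n)"
        unfolding lborel_pow_def by measurable
      then show ?thesis using False by (simp add: C_map_def)
    qed
  next
    show "C_map n \<in> space (lborel_pow n) \<rightarrow> {1..n+1} \<rightarrow>\<^sub>E space borel"
      by (auto simp: lborel_pow_def space_PiM C_map_def PiE_iff extensional_def)
  qed
  then show "C_map n \<in> restrict_space (lborel_pow n) (B_set n) \<rightarrow>\<^sub>M (\<Pi>\<^sub>M i\<in>{1..n+1}. borel)"
    by (rule measurable_restrict_space1)
qed

lemma H_map_in_C_set:
  assumes n: "1 \<le> n" and y: "y \<in> pos_orthant (n+1)"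
  shows "H_map n y \<in> C_set n"
proof -
  let ?s = "\<Sum>j=1..n+1. y j"
  have pos: "0 < y i" if "i \<in> {1..n+1}" for i
    using y that by (auto simp: pos_orthant_def PiE_iff)
  have s: "0 < ?s" by (intro sum_pos pos) auto
  have less: "y i < ?s" if i: "i \<in> {1..n+1}" for i
  proof -
    have "0 < (\<Sum>j\<in>{1..n+1} - {i}. y j)"
    proof (rule sum_pos)
      have "card ({1..n+1} - {i}) = n" using i by simp
      then show "{1..n+1} - {i} \<noteq> {}" using n by (metis card.empty not_one_le_zero)
    qed (use pos in auto)
    moreover have "?s = y i + (\<Sum>j\<in>{1..n+1} - {i}. y j)"
      using i by (intro sum.remove) auto
    ultimately show ?thesis by simp
  qed
  have "(\<Sum>i=1..n+1. H_map n y i) = (\<Sum>i=1..n+1. y i / ?s)"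
    by (rule sum.cong) (auto simp only: H_map_def restrict_apply if_True)
  also have "\<dots> = 1" using s by (simp only: sum_divide_distrib[symmetric]) simp
  finally have "(\<Sum>i=1..n+1. H_map n y i) = 1" .
  moreover have "H_map n y \<in> {1..n+1} \<rightarrow>\<^sub>E {0<..<1}"
    unfolding H_map_def using pos less s
    by (intro restrict_PiE_iff[THEN iffD2] ballI) (simp only: greaterThanLessThan_iff divide_less_eq_1_pos divide_pos_pos)
  ultimately show ?thesis by (simp only: C_set_def mem_Collect_eq)
qed

lemma measurable_H_map:
  assumes n: "1 \<le> n"
  shows "H_map n \<in> multi_Gamma n \<alpha> \<beta> \<rightarrow>\<^sub>M C_borel n"
proof -
  have "H_map n \<in> lborel_pow (n+1) \<rightarrow>\<^sub>M (\<Pi>\<^sub>M i\<in>{1..n+1}. borel)"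
    unfolding H_map_def lborel_pow_def by measurable
  then have "H_map n \<in> restrict_space (lborel_pow (n+1)) (pos_orthant (n+1)) \<rightarrow>\<^sub>M C_borel n"
    unfolding C_borel_def
    by (intro measurable_restrict_space2 measurable_restrict_space1)
       (auto simp: space_restrict_space H_map_in_C_set[OF n, simplified])
  then show ?thesis by (simp add: multi_Gamma_def)
qed

end

theory Submission
  imports Defs
begin

text \<open>
  Every point of the open orthant is \<open>s \<cdot> c\<close> for a unique \<open>s > 0\<close> (the sum of its coordinates)
  and a unique \<open>c\<close> in the simplex, and the homogeneous transform forgets \<open>s\<close>. If \<open>c\<close> is
  parametrised by \<open>x \<in> B_set n\<close>, Lebesgue measure becomes \<open>s\<^sup>n ds dx\<close>
  (\<open>nn_integral_cone_coordinates\<close>). That formula is obtained without a Jacobian determinant: the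
  change of variables is a shift of the last coordinate on each line, which makes it the sum \<open>s\<close>,
  followed by a dilation by \<open>s\<close> of the other \<open>n\<close> coordinates on each slice, and Tonelli's theorem
  glues the lines and the slices together.

  The density of the image measure at \<open>c\<close> is therefore the integral of \<open>s\<^sup>n\<close> times the Gamma density
  along the ray through \<open>c\<close>. There the product of the Gamma densities is a constant times
  \<open>s powr (A - n - 1) * exp (- L s)\<close>, where \<open>A\<close> is the sum of the \<open>\<alpha> i\<close> and \<open>L\<close> the linear form
  with coefficients \<open>\<beta> i\<close> at \<open>c\<close>. So the ray integral is one Euler integral, which gives the
  factor \<open>Gamma A / L powr A\<close> (\<open>nn_integral_ray\<close>).

  This produces the constant \<open>Gamma A / (\<Prod>i. Gamma (\<alpha> i))\<close> where the claim has the reciprocal of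
  the multivariate Beta function. The two agree (\<open>multi_Beta_eq\<close>) by the same computation: for
  \<open>\<beta> = 1\<close> the linear form is identically 1 on the simplex, and the image measure has mass 1. The
  factor \<open>sqrt (n + 1)\<close> of the reference measure cancels against the one in \<open>g\<close>, and the
  uniqueness of Radon-Nikodym derivatives with respect to a finite measure yields the last claim.
\<close>

section \<open>Dilations of Lebesgue measure\<close>

text \<open>Tonelli's theorem reduces this to the one-dimensional substitution rule, one coordinate at a
  time.\<close>

lemma nn_integral_PiM_lborel_scale:
  fixes f :: "('i \<Rightarrow> real) \<Rightarrow> ennreal"
  assumes "finite I" and s: "0 < s"
    and "f \<in> borel_measurable (\<Pi>\<^sub>M i\<in>I. lborel)"
  shows "(\<integral>\<^sup>+x. f x \<partial>(\<Pi>\<^sub>M i\<in>I. lborel)) =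
    (\<integral>\<^sup>+x. ennreal (s ^ card I) * f (\<lambda>i\<in>I. s * x i) \<partial>(\<Pi>\<^sub>M i\<in>I. lborel))"
  using assms(1,3)
proof (induction I arbitrary: f)
  case empty
  then show ?case
    by (simp add: PiM_empty nn_integral_count_space_finite restrict_def)
next
  case (insert j I)
  interpret product_sigma_finite "\<lambda>_::'i. lborel :: real measure"
    by standard
  note insert.prems[measurable]
  have [measurable]: "(\<lambda>(x, t). f (x(j := t))) \<in> borel_measurable ((\<Pi>\<^sub>M i\<in>I. lborel) \<Otimes>\<^sub>M lborel)"
    using measurable_compose[OF measurable_add_dim[of j I "\<lambda>_. lborel"] insert.prems]
    by (simp add: split_beta')
  have [measurable]: "(\<lambda>x. \<lambda>i\<in>I. s * x i) \<in> (\<Pi>\<^sub>M i\<in>I. lborel) \<rightarrow>\<^sub>M (\<Pi>\<^sub>M i\<in>I. lborel)"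
    by (intro measurable_restrict) measurable
  have [measurable]: "(\<lambda>x. \<lambda>i\<in>insert j I. s * x i) \<in>
      (\<Pi>\<^sub>M i\<in>insert j I. lborel) \<rightarrow>\<^sub>M (\<Pi>\<^sub>M i\<in>insert j I. lborel)"
    by (intro measurable_restrict) measurable
  have one_coordinate: "(\<integral>\<^sup>+t. f (x(j := t)) \<partial>lborel) = ennreal s * (\<integral>\<^sup>+t. f (x(j := s * t)) \<partial>lborel)"
    if x: "x \<in> space (\<Pi>\<^sub>M i\<in>I. lborel)" for x
  proof -
    have "(\<lambda>t. f (x(j := t))) \<in> borel_measurable borel"
      using measurable_Pair2[OF \<open>(\<lambda>(x, t). f (x(j := t))) \<in> _\<close> x] by simp
    from nn_integral_real_affine[OF this, of s 0] s show ?thesis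
      by simp
  qed
  have "(\<integral>\<^sup>+x. f x \<partial>(\<Pi>\<^sub>M i\<in>insert j I. lborel)) =
      (\<integral>\<^sup>+x. \<integral>\<^sup>+t. f (x(j := t)) \<partial>lborel \<partial>(\<Pi>\<^sub>M i\<in>I. lborel))"
    using insert by (intro product_nn_integral_insert) auto
  also have "\<dots> = (\<integral>\<^sup>+x. ennreal (s ^ card I) *
      (\<integral>\<^sup>+t. f ((\<lambda>i\<in>I. s * x i)(j := t)) \<partial>lborel) \<partial>(\<Pi>\<^sub>M i\<in>I. lborel))"
    by (rule insert.IH) measurable
  also have "\<dots> = (\<integral>\<^sup>+x. \<integral>\<^sup>+t. ennreal (s ^ card (insert j I)) *
      f (\<lambda>i\<in>insert j I. s * (x(j := t)) i) \<partial>lborel \<partial>(\<Pi>\<^sub>M i\<in>I. lborel))"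
  proof (rule nn_integral_cong)
    fix x assume x: "x \<in> space (\<Pi>\<^sub>M i\<in>I. lborel :: real measure)"
    have sx: "(\<lambda>i\<in>I. s * x i) \<in> space (\<Pi>\<^sub>M i\<in>I. lborel)"
      by (simp add: space_PiM)
    have "(\<lambda>t. f ((\<lambda>i\<in>I. s * x i)(j := t))) \<in> borel_measurable borel"
      using measurable_Pair2[OF \<open>(\<lambda>(x, t). f (x(j := t))) \<in> _\<close> sx] by simp
    then have [measurable]: "(\<lambda>t. f ((\<lambda>i\<in>I. s * x i)(j := s * t))) \<in> borel_measurable lborel"
      by (rule measurable_compose[rotated]) simp
    have upd: "(\<lambda>i\<in>insert j I. s * (x(j := t)) i) = (\<lambda>i\<in>I. s * x i)(j := s * t)" for t
      using insert.hyps by auto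
    show "ennreal (s ^ card I) * (\<integral>\<^sup>+t. f ((\<lambda>i\<in>I. s * x i)(j := t)) \<partial>lborel) =
        (\<integral>\<^sup>+t. ennreal (s ^ card (insert j I)) * f (\<lambda>i\<in>insert j I. s * (x(j := t)) i) \<partial>lborel)"
    proof -
      have "ennreal (s ^ card (insert j I)) = ennreal (s ^ card I) * ennreal s"
        using insert.hyps s by (simp add: ennreal_mult mult.commute)
      moreover have "(\<integral>\<^sup>+t. ennreal (s ^ card (insert j I)) * f ((\<lambda>i\<in>I. s * x i)(j := s * t)) \<partial>lborel) =
          ennreal (s ^ card (insert j I)) * (\<integral>\<^sup>+t. f ((\<lambda>i\<in>I. s * x i)(j := s * t)) \<partial>lborel)"
        by (rule nn_integral_cmult) measurable
      ultimately show ?thesis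
        by (simp only: one_coordinate[OF sx] upd mult.assoc)
    qed
  qed
  also have "\<dots> = (\<integral>\<^sup>+x. ennreal (s ^ card (insert j I)) * f (\<lambda>i\<in>insert j I. s * x i)
      \<partial>(\<Pi>\<^sub>M i\<in>insert j I. lborel))"
    using insert by (intro product_nn_integral_insert[symmetric]) auto
  finally show ?case .
qed

section \<open>The orthant as a cone over the simplex\<close>

lemma sets_pos_orthant: "pos_orthant n \<in> sets (lborel_pow n)"
  unfolding pos_orthant_def lborel_pow_def by (intro sets_PiM_I_finite) auto

lemma sets_B_set: "B_set n \<in> sets (lborel_pow n)"
proof -
  have [measurable]: "({1..n} \<rightarrow>\<^sub>E {0<..<1}) \<in> sets (\<Pi>\<^sub>M i\<in>{1..n}. lborel :: real measure)"
    by (intro sets_PiM_I_finite) auto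
  have "B_set n = ({1..n} \<rightarrow>\<^sub>E {0<..<1}) \<inter>
      {x \<in> space (\<Pi>\<^sub>M i\<in>{1..n}. lborel). (\<Sum>i=1..n. x i) < 1}"
    by (auto simp: B_set_def space_PiM)
  also have "\<dots> \<in> sets (\<Pi>\<^sub>M i\<in>{1..n}. lborel)"
    by measurable
  finally show ?thesis
    by (simp add: lborel_pow_def)
qed

lemma sets_C_set: "C_set n \<in> sets (\<Pi>\<^sub>M i\<in>{1..n+1}. borel)"
proof -
  have [measurable]: "({1..n+1} \<rightarrow>\<^sub>E {0<..<1}) \<in> sets (\<Pi>\<^sub>M i\<in>{1..n+1}. borel :: real measure)"
    by (intro sets_PiM_I_finite) auto
  have "C_set n = ({1..n+1} \<rightarrow>\<^sub>E {0<..<1}) \<inter>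
      {x \<in> space (\<Pi>\<^sub>M i\<in>{1..n+1}. borel). (\<Sum>i=1..n+1. x i) = 1}"
    by (auto simp: C_set_def space_PiM)
  also have "\<dots> \<in> sets (\<Pi>\<^sub>M i\<in>{1..n+1}. borel)"
    by measurable
  finally show ?thesis .
qed

lemma C_map_below: "i \<in> {1..n} \<Longrightarrow> C_map n x i = x i"
  and C_map_last: "C_map n x (n+1) = 1 - (\<Sum>i=1..n. x i)"
  by (auto simp: C_map_def)

lemma sum_C_map: "(\<Sum>i=1..n+1. C_map n x i) = 1"
  by (simp add: C_map_last[simplified] C_map_below)

text \<open>The formulas of the statement become symmetric in all \<open>n + 1\<close> coordinates once they are
  written on the simplex.\<close>

lemma D_fun_eq_prod_C_map:
  "D_fun n \<alpha> x = (\<Prod>i=1..n+1. C_map n x i powr (\<alpha> i - 1))"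
proof -
  have "(\<Prod>i=1..n. C_map n x i powr (\<alpha> i - 1)) = (\<Prod>i=1..n. x i powr (\<alpha> i - 1))"
    by (intro prod.cong) (simp_all add: C_map_below)
  then show ?thesis
    using C_map_last[of n x] by (simp add: D_fun_def)
qed

lemma linear_form_C_map:
  "(\<Sum>i=1..n. \<beta> i * x i) + \<beta> (n+1) * (1 - (\<Sum>i=1..n. x i)) = (\<Sum>i=1..n+1. \<beta> i * C_map n x i)"
proof -
  have "(\<Sum>i=1..n. \<beta> i * C_map n x i) = (\<Sum>i=1..n. \<beta> i * x i)"
    by (intro sum.cong) (simp_all add: C_map_below)
  then show ?thesis
    using C_map_last[of n x] by simp
qed

lemma C_map_pos:
  assumes "x \<in> B_set n" "i \<in> {1..n+1}"
  shows "0 < C_map n x i"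
  using assms C_map_last[of n x]
  by (cases "i = n+1") (auto simp: B_set_def PiE_iff C_map_below)

lemma H_map_scaled_C_map:
  assumes "x \<in> B_set n" "0 < s"
  shows "H_map n (\<lambda>i\<in>{1..n+1}. s * C_map n x i) = C_map n x"
proof -
  have "(\<Sum>j=1..n+1. (\<lambda>i\<in>{1..n+1}. s * C_map n x i) j) = s * (\<Sum>j=1..n+1. C_map n x j)"
    unfolding sum_distrib_left by (intro sum.cong) auto
  then have total: "(\<Sum>j=1..n+1. (\<lambda>i\<in>{1..n+1}. s * C_map n x i) j) = s"
    by (simp only: sum_C_map mult_1_right)
  have "C_map n x \<in> extensional {1..n+1}"
    using assms(1) by (auto simp: B_set_def PiE_def extensional_def C_map_def)
  then show ?thesis
    unfolding H_map_def total using assms(2) by (auto simp: fun_eq_iff extensional_def)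
qed

text \<open>The image of the orthant under the change of variables is \<open>{0<..} \<times> B_set n\<close>: positivity of
  the \<open>n + 1\<close> coordinates already forces the upper bounds \<open>x i < 1\<close>.\<close>

lemma scaled_C_map_in_pos_orthant_iff:
  assumes s: "0 < s" and x: "x \<in> extensional {1..n}"
  shows "(\<lambda>i\<in>{1..n+1}. s * C_map n x i) \<in> pos_orthant (n+1) \<longleftrightarrow> x \<in> B_set n"
proof -
  have "(\<lambda>i\<in>{1..n+1}. s * C_map n x i) \<in> pos_orthant (n+1) \<longleftrightarrow>
      (\<forall>i\<in>{1..n+1}. 0 < C_map n x i)"
    using s by (simp add: pos_orthant_def PiE_iff zero_less_mult_iff)
  also have "\<dots> \<longleftrightarrow> (\<forall>i\<in>{1..n}. 0 < x i) \<and> (\<Sum>i=1..n. x i) < 1"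
    using C_map_last[of n x] by (auto simp: C_map_below atLeastAtMostSuc_conv)
  also have "\<dots> \<longleftrightarrow> x \<in> B_set n"
  proof
    assume *: "(\<forall>i\<in>{1..n}. 0 < x i) \<and> (\<Sum>i=1..n. x i) < 1"
    have "x i < 1" if "i \<in> {1..n}" for i
    proof -
      have "x i \<le> (\<Sum>i=1..n. x i)"
        using * that by (intro member_le_sum) (auto intro: less_imp_le)
      with * show ?thesis
        by linarith
    qed
    with * x show "x \<in> B_set n"
      by (auto simp: B_set_def PiE_iff)
  qed (auto simp: B_set_def PiE_iff)
  finally show ?thesis .
qed

text \<open>
  Integrate the last coordinate first and replace it by the sum \<open>s\<close> of all coordinates, which is a
  shift (\<open>shift\<close>). For fixed \<open>s\<close>, the remaining coordinates are then dilated by \<open>s\<close> (\<open>slice\<close>);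
  this is the source of the weight \<open>s\<^sup>n\<close>.
\<close>

lemma nn_integral_cone_coordinates:
  fixes F :: "(nat \<Rightarrow> real) \<Rightarrow> ennreal"
  assumes F: "F \<in> borel_measurable (lborel_pow (n+1))"
  shows "(\<integral>\<^sup>+y\<in>pos_orthant (n+1). F y \<partial>lborel_pow (n+1)) =
    (\<integral>\<^sup>+x\<in>B_set n. (\<integral>\<^sup>+s\<in>{0<..}. ennreal (s ^ n) * F (\<lambda>i\<in>{1..n+1}. s * C_map n x i) \<partial>lborel)
       \<partial>lborel_pow n)"
proof -
  interpret product_sigma_finite "\<lambda>_::nat. lborel :: real measure"
    by standard
  interpret P: finite_product_sigma_finite "\<lambda>_::nat. lborel :: real measure" "{1..n}"
    by standard auto
  interpret PL: pair_sigma_finite "\<Pi>\<^sub>M i\<in>{1..n}. lborel :: real measure" "lborel :: real measure"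
    by standard
  let ?P = "\<Pi>\<^sub>M i\<in>{1..n}. lborel :: real measure"
  let ?y = "\<lambda>x s. \<lambda>i\<in>{1..n+1}. s * C_map n x i"
  define G where "G = (\<lambda>y. F y * indicator (pos_orthant (n+1)) y)"
  have ins: "{1..n+1} = insert (n+1) {1..n}"
    by auto
  have pow: "lborel_pow (n+1) = (\<Pi>\<^sub>M i\<in>insert (n+1) {1..n}. lborel)"
    by (simp only: lborel_pow_def ins)
  have G: "G \<in> borel_measurable (\<Pi>\<^sub>M i\<in>insert (n+1) {1..n}. lborel)"
    unfolding G_def pow[symmetric] using F sets_pos_orthant[of "n+1"] by measurable
  have [measurable]: "(\<lambda>(x, t). G (x(n+1 := t))) \<in> borel_measurable (?P \<Otimes>\<^sub>M lborel)"
    using measurable_compose[OF measurable_add_dim[of "n+1" "{1..n}" "\<lambda>_. lborel"] G]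
    by (simp add: split_beta')
  have [measurable]: "(\<lambda>(x, s). G (x(n+1 := s - (\<Sum>i=1..n. x i)))) \<in> borel_measurable (?P \<Otimes>\<^sub>M lborel)"
  proof -
    have "(\<lambda>(x, s). (x, s - (\<Sum>i=1..n. x i))) \<in> ?P \<Otimes>\<^sub>M lborel \<rightarrow>\<^sub>M ?P \<Otimes>\<^sub>M lborel"
      by measurable
    from measurable_compose[OF this \<open>(\<lambda>(x, t). G (x(n+1 := t))) \<in> _\<close>] show ?thesis
      by (simp add: split_beta')
  qed
  have [measurable]: "(\<lambda>(x, s). ?y x s) \<in> ?P \<Otimes>\<^sub>M lborel \<rightarrow>\<^sub>M (\<Pi>\<^sub>M i\<in>insert (n+1) {1..n}. lborel)"
    unfolding ins split_beta'
  proof (intro measurable_restrict)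
    fix i assume i: "i \<in> insert (n+1) {1..n}"
    show "(\<lambda>p. snd p * C_map n (fst p) i) \<in> ?P \<Otimes>\<^sub>M lborel \<rightarrow>\<^sub>M lborel"
      using i by (cases "i = n+1") (auto simp: C_map_def)
  qed
  have [measurable]: "(\<lambda>(x, s). G (?y x s)) \<in> borel_measurable (?P \<Otimes>\<^sub>M lborel)"
    using measurable_compose[OF \<open>(\<lambda>(x, s). ?y x s) \<in> _\<close> G] by (simp add: split_beta')

  have shift: "(\<integral>\<^sup>+t. G (x(n+1 := t)) \<partial>lborel) =
      (\<integral>\<^sup>+s. G (x(n+1 := s - (\<Sum>i=1..n. x i))) \<partial>lborel)" if x: "x \<in> space ?P" for x
  proof -
    have "(\<lambda>t. G (x(n+1 := t))) \<in> borel_measurable borel"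
      using measurable_Pair2[OF \<open>(\<lambda>(x, t). G (x(n+1 := t))) \<in> _\<close> x] by simp
    from nn_integral_real_affine[OF this, of 1 "- (\<Sum>i=1..n. x i)"] show ?thesis
      by simp
  qed
  have slice: "(\<integral>\<^sup>+x. G (x(n+1 := s - (\<Sum>i=1..n. x i))) \<partial>?P) =
      (\<integral>\<^sup>+x. ennreal (s ^ n) * G (?y x s) * indicator {0<..} s \<partial>?P)" for s :: real
  proof (cases "0 < s")
    case True
    have "(\<lambda>x. G (x(n+1 := s - (\<Sum>i=1..n. x i)))) \<in> borel_measurable ?P"
      by measurable
    from nn_integral_PiM_lborel_scale[OF finite_atLeastAtMost True this]
    have "(\<integral>\<^sup>+x. G (x(n+1 := s - (\<Sum>i=1..n. x i))) \<partial>?P) = (\<integral>\<^sup>+x. ennreal (s ^ n) *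
        G ((\<lambda>i\<in>{1..n}. s * x i)(n+1 := s - (\<Sum>i=1..n. (\<lambda>i\<in>{1..n}. s * x i) i))) \<partial>?P)"
      by simp
    also have "\<dots> = (\<integral>\<^sup>+x. ennreal (s ^ n) * G (?y x s) * indicator {0<..} s \<partial>?P)"
    proof (rule nn_integral_cong)
      fix x
      have "(\<lambda>i\<in>{1..n}. s * x i)(n+1 := s - (\<Sum>i=1..n. (\<lambda>i\<in>{1..n}. s * x i) i)) = ?y x s"
        by (auto simp: fun_eq_iff C_map_def sum_distrib_left right_diff_distrib)
      then show "ennreal (s ^ n) *
          G ((\<lambda>i\<in>{1..n}. s * x i)(n+1 := s - (\<Sum>i=1..n. (\<lambda>i\<in>{1..n}. s * x i) i))) =
          ennreal (s ^ n) * G (?y x s) * indicator {0<..} s"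
        using True by simp
    qed
    finally show ?thesis .
  next
    case False
    \<comment> \<open>Both sides vanish: the coordinates of a point of the orthant have a positive sum.\<close>
    have "G (x(n+1 := s - (\<Sum>i=1..n. x i))) = 0" for x
    proof -
      let ?z = "x(n+1 := s - (\<Sum>i=1..n. x i))"
      have "?z \<notin> pos_orthant (n+1)"
      proof
        assume "?z \<in> pos_orthant (n+1)"
        then have "0 < ?z i" if "i \<in> {1..n+1}" for i
          using that unfolding pos_orthant_def by (auto simp only: PiE_iff greaterThan_iff)
        then have "0 < (\<Sum>i=1..n+1. ?z i)"
          by (intro sum_pos) auto
        also have "(\<Sum>i=1..n+1. ?z i) = s"
          by simp
        finally show False
          using False by simp
      qed
      then show ?thesis
        by (simp add: G_def)
    qed
    with False show ?thesis
      by simp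
  qed

  have "(\<integral>\<^sup>+y. G y \<partial>lborel_pow (n+1)) = (\<integral>\<^sup>+x. \<integral>\<^sup>+t. G (x(n+1 := t)) \<partial>lborel \<partial>?P)"
    unfolding pow using G by (intro product_nn_integral_insert) auto
  also have "\<dots> = (\<integral>\<^sup>+x. \<integral>\<^sup>+s. G (x(n+1 := s - (\<Sum>i=1..n. x i))) \<partial>lborel \<partial>?P)"
    by (intro nn_integral_cong shift)
  also have "\<dots> = (\<integral>\<^sup>+s. \<integral>\<^sup>+x. G (x(n+1 := s - (\<Sum>i=1..n. x i))) \<partial>?P \<partial>lborel)"
    by (rule PL.Fubini'[symmetric]) measurable
  also have "\<dots> = (\<integral>\<^sup>+s. \<integral>\<^sup>+x. ennreal (s ^ n) * G (?y x s) * indicator {0<..} s \<partial>?P \<partial>lborel)"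
    by (simp only: slice)
  also have "\<dots> = (\<integral>\<^sup>+x. \<integral>\<^sup>+s. ennreal (s ^ n) * G (?y x s) * indicator {0<..} s \<partial>lborel \<partial>?P)"
    by (rule PL.Fubini') measurable
  also have "\<dots> = (\<integral>\<^sup>+x. (\<integral>\<^sup>+s. ennreal (s ^ n) * F (?y x s) * indicator {0<..} s \<partial>lborel)
       * indicator (B_set n) x \<partial>?P)"
  proof (rule nn_integral_cong)
    fix x assume "x \<in> space ?P"
    then have ext: "x \<in> extensional {1..n}"
      by (simp add: space_PiM PiE_def)
    have "ennreal (s ^ n) * G (?y x s) * indicator {0<..} s =
        ennreal (s ^ n) * F (?y x s) * indicator {0<..} s * indicator (B_set n) x" for s
      using scaled_C_map_in_pos_orthant_iff[OF _ ext, of s]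
      by (auto simp: G_def indicator_def)
    then show "(\<integral>\<^sup>+s. ennreal (s ^ n) * G (?y x s) * indicator {0<..} s \<partial>lborel) =
        (\<integral>\<^sup>+s. ennreal (s ^ n) * F (?y x s) * indicator {0<..} s \<partial>lborel) * indicator (B_set n) x"
      by (simp only:) (simp add: indicator_def)
  qed
  finally show ?thesis
    by (simp add: G_def lborel_pow_def)
qed

section \<open>Gamma densities\<close>

text \<open>Euler's integral for \<open>Gamma a\<close> after the substitution \<open>t = b s\<close>.\<close>

lemma nn_integral_powr_exp:
  fixes a b :: real
  assumes a: "0 < a" and b: "0 < b"
  shows "(\<integral>\<^sup>+s\<in>{0<..}. ennreal (s powr (a - 1) * exp (- b * s)) \<partial>lborel) =
    ennreal (Gamma a / b powr a)"
proof -
  have "ennreal (Gamma a) = (\<integral>\<^sup>+t. ennreal (indicator {0..} t * t powr (a - 1) / exp t) \<partial>lborel)"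
    by (rule Gamma_conv_nn_integral_real[OF a])
  also have "\<dots> = ennreal b * (\<integral>\<^sup>+s. ennreal (indicator {0..} (b * s) * (b * s) powr (a - 1) / exp (b * s)) \<partial>lborel)"
    using b by (subst nn_integral_real_affine[where c = b and t = 0]) auto
  also have "\<dots> = ennreal b * (\<integral>\<^sup>+s. ennreal (b powr (a - 1)) *
      (ennreal (s powr (a - 1) * exp (- b * s)) * indicator {0<..} s) \<partial>lborel)"
    using b
    by (intro arg_cong2[where f = "(*)"] nn_integral_cong)
       (auto simp: indicator_def powr_mult exp_minus field_simps zero_le_mult_iff
             simp flip: ennreal_mult)
  also have "\<dots> = ennreal (b * b powr (a - 1)) *
      (\<integral>\<^sup>+s. ennreal (s powr (a - 1) * exp (- b * s)) * indicator {0<..} s \<partial>lborel)"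
    using b by (subst nn_integral_cmult) (auto simp: ennreal_mult mult.assoc)
  also have "b * b powr (a - 1) = b powr a"
    using b by (simp add: powr_mult_base)
  finally have *: "ennreal (Gamma a) = ennreal (b powr a) *
      (\<integral>\<^sup>+s. ennreal (s powr (a - 1) * exp (- b * s)) * indicator {0<..} s \<partial>lborel)"
    (is "_ = _ * ?I") .
  have "ennreal (Gamma a / b powr a) = ennreal (1 / b powr a) * ennreal (Gamma a)"
    using a b by (simp flip: ennreal_mult)
  also have "\<dots> = ennreal (1 / b powr a * b powr a) * ?I"
    unfolding * using b by (subst ennreal_mult) (auto simp: mult.assoc)
  finally show ?thesis
    using b by simp
qed

lemma nn_integral_gamma_density:
  assumes a: "0 < a" and b: "0 < b"
  shows "(\<integral>\<^sup>+x\<in>{0<..}. ennreal (gamma_density a b x) \<partial>lborel) = 1"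
proof -
  have "(\<integral>\<^sup>+x. ennreal (gamma_density a b x) * indicator {0<..} x \<partial>lborel) =
      (\<integral>\<^sup>+x. ennreal (b powr a / Gamma a) *
        (ennreal (x powr (a - 1) * exp (- b * x)) * indicator {0<..} x) \<partial>lborel)"
    using a b
    by (intro nn_integral_cong)
       (auto simp: gamma_density_def indicator_def mult_ac simp flip: ennreal_mult)
  also have "\<dots> = ennreal (b powr a / Gamma a) * ennreal (Gamma a / b powr a)"
    using nn_integral_powr_exp[OF a b] by (subst nn_integral_cmult) auto
  also have "\<dots> = 1"
    using b Gamma_real_pos[OF a] by (simp flip: ennreal_mult)
  finally show ?thesis .
qed

text \<open>Along the ray \<open>s \<mapsto> s \<cdot> c\<close>, a product of Gamma densities is again a Gamma density in \<open>s\<close> up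
  to a constant factor and a power of \<open>s\<close>: the exponents of \<open>s\<close> and the rates add up.\<close>

lemma prod_gamma_density_scaled:
  fixes a b c :: "'i \<Rightarrow> real"
  assumes "finite I" and s: "0 < s" and c: "\<And>i. i \<in> I \<Longrightarrow> 0 < c i"
  shows "(\<Prod>i\<in>I. gamma_density (a i) (b i) (s * c i)) =
    (\<Prod>i\<in>I. b i powr a i) / (\<Prod>i\<in>I. Gamma (a i)) * (\<Prod>i\<in>I. c i powr (a i - 1)) *
    (s powr ((\<Sum>i\<in>I. a i) - card I) * exp (- (\<Sum>i\<in>I. b i * c i) * s))"
  using assms(1) c
proof (induction I)
  case empty
  then show ?case
    using s by simp
next
  case (insert j I)
  have "s powr ((\<Sum>i\<in>insert j I. a i) - card (insert j I)) =
      s powr (a j - 1) * s powr ((\<Sum>i\<in>I. a i) - card I)"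
    using insert.hyps by (simp add: powr_add[symmetric] algebra_simps)
  moreover have "exp (- (\<Sum>i\<in>insert j I. b i * c i) * s) =
      exp (- b j * (s * c j)) * exp (- (\<Sum>i\<in>I. b i * c i) * s)"
    using insert.hyps by (simp add: exp_add[symmetric] algebra_simps)
  moreover have "(s * c j) powr (a j - 1) = s powr (a j - 1) * c j powr (a j - 1)"
    using s insert.prems[of j] by (simp add: powr_mult)
  moreover have "(\<Prod>i\<in>I. gamma_density (a i) (b i) (s * c i)) =
    (\<Prod>i\<in>I. b i powr a i) / (\<Prod>i\<in>I. Gamma (a i)) * (\<Prod>i\<in>I. c i powr (a i - 1)) *
    (s powr ((\<Sum>i\<in>I. a i) - card I) * exp (- (\<Sum>i\<in>I. b i * c i) * s))"
    using insert by simp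
  ultimately show ?case
    using insert.hyps by (simp add: gamma_density_def del: sum.insert)
qed

section \<open>Projecting the Gamma distribution along rays\<close>

text \<open>The density of the image measure with respect to Lebesgue measure on \<open>B_set n\<close>, as a function
  on the simplex. Its constant has the Gamma functions in place of the multivariate Beta function, as
  the ray integral produces it.\<close>

definition cone_density :: "nat \<Rightarrow> (nat \<Rightarrow> real) \<Rightarrow> (nat \<Rightarrow> real) \<Rightarrow> (nat \<Rightarrow> real) \<Rightarrow> real" where
  "cone_density n \<alpha> \<beta> c =
    (\<Prod>i=1..n+1. \<beta> i powr \<alpha> i) / (\<Prod>i=1..n+1. Gamma (\<alpha> i)) *
    (\<Prod>i=1..n+1. c i powr (\<alpha> i - 1)) *
    (Gamma (\<Sum>i=1..n+1. \<alpha> i) / (\<Sum>i=1..n+1. \<beta> i * c i) powr (\<Sum>i=1..n+1. \<alpha> i))"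

context
  fixes n :: nat and \<alpha> \<beta> :: "nat \<Rightarrow> real"
  assumes \<alpha>: "\<And>i. i \<in> {1..n+1} \<Longrightarrow> 0 < \<alpha> i"
    and \<beta>: "\<And>i. i \<in> {1..n+1} \<Longrightarrow> 0 < \<beta> i"
begin

lemma nn_integral_ray:
  assumes x: "x \<in> B_set n"
  shows "(\<integral>\<^sup>+s\<in>{0<..}. ennreal (s ^ n) *
      ennreal (\<Prod>i=1..n+1. gamma_density (\<alpha> i) (\<beta> i) (s * C_map n x i)) \<partial>lborel) =
    ennreal (cone_density n \<alpha> \<beta> (C_map n x))"
proof -
  let ?A = "\<Sum>i=1..n+1. \<alpha> i" and ?L = "\<Sum>i=1..n+1. \<beta> i * C_map n x i"
  let ?K = "(\<Prod>i=1..n+1. \<beta> i powr \<alpha> i) / (\<Prod>i=1..n+1. Gamma (\<alpha> i)) *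
    (\<Prod>i=1..n+1. C_map n x i powr (\<alpha> i - 1))"
  have K: "0 \<le> ?K"
    using \<alpha> by (intro mult_nonneg_nonneg divide_nonneg_nonneg prod_nonneg)
      (auto intro: Gamma_real_nonneg less_imp_le)
  have A: "0 < ?A"
    using \<alpha> by (intro sum_pos) auto
  have L: "0 < ?L"
    using \<beta> C_map_pos[OF x] by (intro sum_pos mult_pos_pos) auto
  have radial: "ennreal (s ^ n) * ennreal (\<Prod>i=1..n+1. gamma_density (\<alpha> i) (\<beta> i) (s * C_map n x i)) =
      ennreal ?K * ennreal (s powr (?A - 1) * exp (- ?L * s))" if s: "0 < s" for s
  proof -
    have "(\<Prod>i=1..n+1. gamma_density (\<alpha> i) (\<beta> i) (s * C_map n x i)) =
        ?K * (s powr (?A - (n + 1)) * exp (- ?L * s))"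
      using prod_gamma_density_scaled[OF finite_atLeastAtMost s, of 1 "n+1" "C_map n x" \<alpha> \<beta>]
        C_map_pos[OF x] by (simp only: card_atLeastAtMost) simp
    \<comment> \<open>The volume factor turns the exponent of \<open>s\<close> into that of an Euler integral.\<close>
    moreover have "s ^ n * s powr (?A - (n + 1)) = s powr (?A - 1)"
    proof -
      have "s ^ n * s powr (?A - (n + 1)) = s powr (real n + (?A - (n + 1)))"
        using s by (simp only: powr_add powr_realpow)
      also have "real n + (?A - (n + 1)) = ?A - 1"
        by simp
      finally show ?thesis .
    qed
    ultimately have "s ^ n * (\<Prod>i=1..n+1. gamma_density (\<alpha> i) (\<beta> i) (s * C_map n x i)) =
        ?K * (s powr (?A - 1) * exp (- ?L * s))"
      using mult.left_commute[of "s ^ n" ?K] by (simp only: mult.assoc[of "s ^ n", symmetric])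
    then show ?thesis
      using s K by (simp only: ennreal_mult'[symmetric] zero_le_power less_imp_le)
  qed
  have "(\<integral>\<^sup>+s\<in>{0<..}. ennreal (s ^ n) *
      ennreal (\<Prod>i=1..n+1. gamma_density (\<alpha> i) (\<beta> i) (s * C_map n x i)) \<partial>lborel) =
    (\<integral>\<^sup>+s. ennreal ?K * (ennreal (s powr (?A - 1) * exp (- ?L * s)) * indicator {0<..} s) \<partial>lborel)"
  proof (intro nn_integral_cong)
    fix s :: real
    show "ennreal (s ^ n) * ennreal (\<Prod>i=1..n+1. gamma_density (\<alpha> i) (\<beta> i) (s * C_map n x i)) *
        indicator {0<..} s =
      ennreal ?K * (ennreal (s powr (?A - 1) * exp (- ?L * s)) * indicator {0<..} s)"
    proof (cases "0 < s")
      case True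
      show ?thesis
        by (simp only: radial[OF True] mult.assoc)
    qed simp
  qed
  also have "\<dots> = ennreal ?K * ennreal (Gamma ?A / ?L powr ?A)"
    by (subst nn_integral_cmult) (simp_all only: nn_integral_powr_exp[OF A L], measurable)
  also have "\<dots> = ennreal (cone_density n \<alpha> \<beta> (C_map n x))"
    unfolding cone_density_def by (rule ennreal_mult'[symmetric, OF K])
  finally show ?thesis .
qed

text \<open>In cone coordinates the indicator of the preimage of \<open>E\<close> is constant on rays, so it leaves the
  inner integral.\<close>

lemma nn_integral_projection_of_Gamma:
  assumes E: "E \<in> sets (\<Pi>\<^sub>M i\<in>{1..n+1}. borel)"
  shows "(\<integral>\<^sup>+y\<in>pos_orthant (n+1). ennreal (\<Prod>i=1..n+1. gamma_density (\<alpha> i) (\<beta> i) (y i)) *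
      indicator E (H_map n y) \<partial>lborel_pow (n+1)) =
    (\<integral>\<^sup>+x\<in>B_set n. ennreal (cone_density n \<alpha> \<beta> (C_map n x)) * indicator E (C_map n x)
      \<partial>lborel_pow n)"
proof -
  have H: "H_map n \<in> lborel_pow (n+1) \<rightarrow>\<^sub>M (\<Pi>\<^sub>M i\<in>{1..n+1}. borel)"
    unfolding H_map_def lborel_pow_def by measurable
  have ind: "(\<lambda>y. indicator E (H_map n y) :: ennreal) \<in> borel_measurable (lborel_pow (n+1))"
    using measurable_compose[OF H borel_measurable_indicator[OF E]] .
  have "(\<lambda>y. \<Prod>i=1..n+1. gamma_density (\<alpha> i) (\<beta> i) (y i)) \<in> borel_measurable (lborel_pow (n+1))"
    unfolding gamma_density_def lborel_pow_def by measurable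
  then have F: "(\<lambda>y. ennreal (\<Prod>i=1..n+1. gamma_density (\<alpha> i) (\<beta> i) (y i)) *
      indicator E (H_map n y)) \<in> borel_measurable (lborel_pow (n+1))"
    using ind by measurable
  show ?thesis
    unfolding nn_integral_cone_coordinates[OF F]
  proof (intro nn_integral_cong)
    fix x
    let ?y = "\<lambda>s. \<lambda>i\<in>{1..n+1}. s * C_map n x i"
    show "(\<integral>\<^sup>+s\<in>{0<..}. ennreal (s ^ n) * (ennreal (\<Prod>i=1..n+1. gamma_density (\<alpha> i) (\<beta> i) (?y s i)) *
        indicator E (H_map n (?y s))) \<partial>lborel) * indicator (B_set n) x =
      ennreal (cone_density n \<alpha> \<beta> (C_map n x)) * indicator E (C_map n x) * indicator (B_set n) x"
    proof (cases "x \<in> B_set n")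
      case x: True
      have "(\<integral>\<^sup>+s\<in>{0<..}. ennreal (s ^ n) * (ennreal (\<Prod>i=1..n+1. gamma_density (\<alpha> i) (\<beta> i) (?y s i)) *
          indicator E (H_map n (?y s))) \<partial>lborel) =
        (\<integral>\<^sup>+s. ennreal (s ^ n) * ennreal (\<Prod>i=1..n+1. gamma_density (\<alpha> i) (\<beta> i) (s * C_map n x i)) *
          indicator {0<..} s * indicator E (C_map n x) \<partial>lborel)"
      proof (intro nn_integral_cong)
        fix s :: real
        have "(\<Prod>i=1..n+1. gamma_density (\<alpha> i) (\<beta> i) (?y s i)) =
            (\<Prod>i=1..n+1. gamma_density (\<alpha> i) (\<beta> i) (s * C_map n x i))"
          by (intro prod.cong) auto
        then show "ennreal (s ^ n) * (ennreal (\<Prod>i=1..n+1. gamma_density (\<alpha> i) (\<beta> i) (?y s i)) *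
            indicator E (H_map n (?y s))) * indicator {0<..} s =
          ennreal (s ^ n) * ennreal (\<Prod>i=1..n+1. gamma_density (\<alpha> i) (\<beta> i) (s * C_map n x i)) *
            indicator {0<..} s * indicator E (C_map n x)"
          using H_map_scaled_C_map[OF x, of s]
          by (cases "0 < s") (simp_all add: mult_ac del: prod.cl_ivl_Suc)
      qed
      also have "\<dots> = ennreal (cone_density n \<alpha> \<beta> (C_map n x)) * indicator E (C_map n x)"
        unfolding nn_integral_ray[OF x, symmetric]
        by (intro nn_integral_multc) (unfold gamma_density_def, measurable)
      finally show ?thesis
        by simp
    qed simp
  qed
qed

lemma nn_integral_gamma_product:
  "(\<integral>\<^sup>+y\<in>pos_orthant (n+1). ennreal (\<Prod>i=1..n+1. gamma_density (\<alpha> i) (\<beta> i) (y i))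
    \<partial>lborel_pow (n+1)) = 1"
proof -
  interpret product_sigma_finite "\<lambda>_::nat. lborel :: real measure"
    by standard
  let ?f = "\<lambda>i t. ennreal (gamma_density (\<alpha> i) (\<beta> i) t) * indicator {0<..} t"
  have "(\<integral>\<^sup>+y\<in>pos_orthant (n+1). ennreal (\<Prod>i=1..n+1. gamma_density (\<alpha> i) (\<beta> i) (y i))
      \<partial>lborel_pow (n+1)) = (\<integral>\<^sup>+y. (\<Prod>i\<in>{1..n+1}. ?f i (y i)) \<partial>lborel_pow (n+1))"
  proof (intro nn_integral_cong)
    fix y assume y: "y \<in> space (lborel_pow (n+1))"
    show "ennreal (\<Prod>i=1..n+1. gamma_density (\<alpha> i) (\<beta> i) (y i)) * indicator (pos_orthant (n+1)) y =
        (\<Prod>i\<in>{1..n+1}. ?f i (y i))"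
    proof (cases "y \<in> pos_orthant (n+1)")
      case True
      then have pos: "0 < y i" if "i \<in> {1..n+1}" for i
        using that unfolding pos_orthant_def by (auto simp only: PiE_iff greaterThan_iff)
      have "(\<Prod>i\<in>{1..n+1}. ?f i (y i)) = (\<Prod>i\<in>{1..n+1}. ennreal (gamma_density (\<alpha> i) (\<beta> i) (y i)))"
        by (intro prod.cong) (use pos in auto)
      also have "\<dots> = ennreal (\<Prod>i=1..n+1. gamma_density (\<alpha> i) (\<beta> i) (y i))"
        by (intro prod_ennreal)
          (use pos \<alpha> \<beta> in \<open>auto simp: gamma_density_def intro: Gamma_real_nonneg less_imp_le\<close>)
      finally show ?thesis
        using True by simp
    next
      case False
      then obtain i where "i \<in> {1..n+1}" "\<not> 0 < y i"
        using y by (auto simp: pos_orthant_def lborel_pow_def space_PiM PiE_iff)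
      then have "(\<Prod>i\<in>{1..n+1}. ?f i (y i)) = 0"
        by (intro prod_zero bexI[of _ i]) auto
      with False show ?thesis
        by simp
    qed
  qed
  also have "\<dots> = (\<Prod>i\<in>{1..n+1}. \<integral>\<^sup>+t. ?f i t \<partial>lborel)"
    unfolding lborel_pow_def
    by (intro product_nn_integral_prod) (auto simp: gamma_density_def)
  also have "\<dots> = (\<Prod>i\<in>{1..n+1}. 1)"
    using \<alpha> \<beta> by (intro prod.cong) (auto simp only: nn_integral_gamma_density)
  finally show ?thesis
    by simp
qed

end

section \<open>The multivariate Beta function\<close>

text \<open>Compare the total masses on both sides of \<open>nn_integral_projection_of_Gamma\<close> for \<open>\<beta> = 1\<close>: the
  Gamma distribution has mass 1, and the linear form in the denominator of \<open>cone_density\<close> is 1 on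
  the simplex, so that only a multiple of \<open>D_fun\<close> is left to integrate.\<close>

lemma multi_Beta_eq:
  assumes \<alpha>: "\<And>i. i \<in> {1..n+1} \<Longrightarrow> 0 < \<alpha> i"
  shows "multi_Beta n \<alpha> = (\<Prod>i=1..n+1. Gamma (\<alpha> i)) / Gamma (\<Sum>i=1..n+1. \<alpha> i)"
proof -
  let ?c = "Gamma (\<Sum>i=1..n+1. \<alpha> i) / (\<Prod>i=1..n+1. Gamma (\<alpha> i))"
  have num: "0 < Gamma (\<Sum>i=1..n+1. \<alpha> i)"
    using \<alpha> by (intro Gamma_real_pos sum_pos) auto
  have den: "0 < (\<Prod>i=1..n+1. Gamma (\<alpha> i))"
    using \<alpha> by (intro prod_pos Gamma_real_pos) auto
  have c: "0 < ?c"
    using num den by (rule divide_pos_pos)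
  have D[measurable]: "D_fun n \<alpha> \<in> borel_measurable (lborel_pow n)"
    unfolding D_fun_def lborel_pow_def by measurable
  have D_nonneg: "0 \<le> D_fun n \<alpha> x" for x
    unfolding D_fun_def by (intro mult_nonneg_nonneg prod_nonneg) auto
  note [measurable] = sets_B_set[of n]
  have "1 = (\<integral>\<^sup>+y\<in>pos_orthant (n+1). ennreal (\<Prod>i=1..n+1. gamma_density (\<alpha> i) 1 (y i)) *
      indicator (space (\<Pi>\<^sub>M i\<in>{1..n+1}. borel)) (H_map n y) \<partial>lborel_pow (n+1))"
  proof -
    have "H_map n y \<in> space (\<Pi>\<^sub>M i\<in>{1..n+1}. borel)" for y
      by (simp add: H_map_def space_PiM)
    then show ?thesis
      using nn_integral_gamma_product[of n \<alpha> "\<lambda>_. 1"] \<alpha> by simp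
  qed
  also have "\<dots> = (\<integral>\<^sup>+x\<in>B_set n. ennreal (cone_density n \<alpha> (\<lambda>_. 1) (C_map n x)) *
      indicator (space (\<Pi>\<^sub>M i\<in>{1..n+1}. borel)) (C_map n x) \<partial>lborel_pow n)"
    using \<alpha> by (intro nn_integral_projection_of_Gamma) auto
  also have "\<dots> = (\<integral>\<^sup>+x. ennreal ?c * ennreal (indicator (B_set n) x * D_fun n \<alpha> x) \<partial>lborel_pow n)"
  proof (intro nn_integral_cong)
    fix x assume "x \<in> space (lborel_pow n)"
    then have "C_map n x \<in> space (\<Pi>\<^sub>M i\<in>{1..n+1}. borel)"
      by (auto simp: lborel_pow_def space_PiM C_map_def PiE_iff extensional_def)
    moreover have "cone_density n \<alpha> (\<lambda>_. 1) (C_map n x) = ?c * D_fun n \<alpha> x"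
      using sum_C_map[of n x] by (simp add: cone_density_def D_fun_eq_prod_C_map)
    moreover from this have "ennreal (cone_density n \<alpha> (\<lambda>_. 1) (C_map n x)) = ennreal ?c * ennreal (D_fun n \<alpha> x)"
      using less_imp_le[OF c] by (simp only: ennreal_mult')
    ultimately show "ennreal (cone_density n \<alpha> (\<lambda>_. 1) (C_map n x)) *
        indicator (space (\<Pi>\<^sub>M i\<in>{1..n+1}. borel)) (C_map n x) * indicator (B_set n) x =
      ennreal ?c * ennreal (indicator (B_set n) x * D_fun n \<alpha> x)"
      by (cases "x \<in> B_set n") simp_all
  qed
  also have "\<dots> = ennreal ?c * (\<integral>\<^sup>+x. ennreal (indicator (B_set n) x * D_fun n \<alpha> x) \<partial>lborel_pow n)"
    by (intro nn_integral_cmult) measurable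
  finally have total: "ennreal ?c * (\<integral>\<^sup>+x. ennreal (indicator (B_set n) x * D_fun n \<alpha> x) \<partial>lborel_pow n) = 1"
    by simp
  have "multi_Beta n \<alpha> = enn2real (\<integral>\<^sup>+x. ennreal (indicator (B_set n) x * D_fun n \<alpha> x) \<partial>lborel_pow n)"
    unfolding multi_Beta_def set_lebesgue_integral_def
    using D_nonneg by (subst integral_eq_nn_integral) (auto simp: mult_nonneg_nonneg)
  moreover have "?c * enn2real (\<integral>\<^sup>+x. ennreal (indicator (B_set n) x * D_fun n \<alpha> x) \<partial>lborel_pow n) = 1"
    using arg_cong[OF total, of enn2real] less_imp_le[OF c] by (simp only: enn2real_mult enn2real_ennreal enn2real_1)
  ultimately show ?thesis
    using num den by (simp add: field_simps)
qed

section \<open>The image measure and its Radon-Nikodym derivative\<close>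

lemma emeasure_distr_multi_Gamma:
  assumes n: "1 \<le> n"
    and \<alpha>: "\<And>i. i \<in> {1..n+1} \<Longrightarrow> 0 < \<alpha> i"
    and \<beta>: "\<And>i. i \<in> {1..n+1} \<Longrightarrow> 0 < \<beta> i"
    and E: "E \<in> sets (C_borel n)"
  shows "emeasure (distr (multi_Gamma n \<alpha> \<beta>) (C_borel n) (H_map n)) E =
    (\<integral>\<^sup>+x\<in>B_set n. ennreal (cone_density n \<alpha> \<beta> (C_map n x)) * indicator E (C_map n x)
      \<partial>lborel_pow n)"
proof -
  have E': "E \<in> sets (\<Pi>\<^sub>M i\<in>{1..n+1}. borel)"
    using E sets_C_set[of n] unfolding C_borel_def
    by (subst (asm) sets_restrict_space_iff) auto
  let ?f = "\<lambda>y. \<Prod>i=1..n+1. gamma_density (\<alpha> i) (\<beta> i) (y i)"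
  let ?R = "restrict_space (lborel_pow (n+1)) (pos_orthant (n+1))"
  have H: "H_map n \<in> ?R \<rightarrow>\<^sub>M C_borel n"
    using measurable_H_map[OF n, of \<alpha> \<beta>] by (simp add: multi_Gamma_def)
  have f: "?f \<in> borel_measurable ?R"
    unfolding gamma_density_def lborel_pow_def by (intro measurable_restrict_space1) measurable
  have "emeasure (distr (multi_Gamma n \<alpha> \<beta>) (C_borel n) (H_map n)) E =
      (\<integral>\<^sup>+z. indicator E z \<partial>distr (multi_Gamma n \<alpha> \<beta>) (C_borel n) (H_map n))"
    using E by simp
  also have "\<dots> = (\<integral>\<^sup>+y. indicator E (H_map n y) \<partial>multi_Gamma n \<alpha> \<beta>)"
    using E measurable_H_map[OF n] by (intro nn_integral_distr) auto
  also have "\<dots> = (\<integral>\<^sup>+y. ennreal (?f y) * indicator E (H_map n y) \<partial>?R)"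
    unfolding multi_Gamma_def
    using f measurable_compose[OF H borel_measurable_indicator[OF E]]
    by (intro nn_integral_density) auto
  also have "\<dots> = (\<integral>\<^sup>+y\<in>pos_orthant (n+1). ennreal (?f y) * indicator E (H_map n y) \<partial>lborel_pow (n+1))"
    using sets_pos_orthant[of "n+1"] by (intro nn_integral_restrict_space) auto
  also have "\<dots> = (\<integral>\<^sup>+x\<in>B_set n. ennreal (cone_density n \<alpha> \<beta> (C_map n x)) * indicator E (C_map n x)
      \<partial>lborel_pow n)"
    using \<alpha> \<beta> E' by (intro nn_integral_projection_of_Gamma) auto
  finally show ?thesis .
qed

lemma nn_integral_mu_C:
  assumes n: "1 \<le> n" and h: "h \<in> borel_measurable (C_borel n)"
  shows "(\<integral>\<^sup>+y. h y \<partial>mu_C n) =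
    (\<integral>\<^sup>+x\<in>B_set n. ennreal (sqrt (real n + 1)) * h (C_map n x) \<partial>lborel_pow n)"
proof -
  note C = measurable_C_map[OF n]
  have hC: "(\<lambda>x. h (C_map n x)) \<in> borel_measurable (restrict_space (lborel_pow n) (B_set n))"
    using measurable_compose[OF C h] .
  have "(\<integral>\<^sup>+y. h y \<partial>mu_C n) =
      (\<integral>\<^sup>+x. h (C_map n x) \<partial>scale_measure (ennreal (sqrt (real n + 1))) (restrict_space (lborel_pow n) (B_set n)))"
    unfolding mu_C_def using C h by (intro nn_integral_distr) (auto cong: measurable_cong_sets)
  also have "\<dots> = (\<integral>\<^sup>+x. ennreal (sqrt (real n + 1)) * h (C_map n x) \<partial>restrict_space (lborel_pow n) (B_set n))"
    using hC by (simp add: nn_integral_scale_measure nn_integral_cmult)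
  also have "\<dots> = (\<integral>\<^sup>+x\<in>B_set n. ennreal (sqrt (real n + 1)) * h (C_map n x) \<partial>lborel_pow n)"
    using sets_B_set[of n] by (intro nn_integral_restrict_space) auto
  finally show ?thesis .
qed

lemma space_mu_C: "space (mu_C n) = C_set n"
  by (auto simp: mu_C_def C_borel_def space_restrict_space space_PiM C_set_def)

lemma sets_mu_C [measurable_cong]: "sets (mu_C n) = sets (C_borel n)"
  by (simp add: mu_C_def)

text \<open>Uniqueness of Radon-Nikodym derivatives needs a \<open>\<sigma>\<close>-finite reference measure; this one is
  finite because \<open>B_set n\<close> lies in the unit cube.\<close>

lemma finite_measure_mu_C:
  assumes n: "1 \<le> n"
  shows "finite_measure (mu_C n)"
proof
  interpret product_sigma_finite "\<lambda>_::nat. lborel :: real measure"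
    by standard
  have "emeasure (lborel_pow n) (B_set n) \<le> emeasure (lborel_pow n) ({1..n} \<rightarrow>\<^sub>E {0<..<1})"
    by (intro emeasure_mono) (auto simp: B_set_def lborel_pow_def intro!: sets_PiM_I_finite)
  also have "\<dots> = 1"
    by (simp add: lborel_pow_def emeasure_PiM)
  finally have B: "emeasure (lborel_pow n) (B_set n) \<le> 1" .
  have "emeasure (mu_C n) (space (mu_C n)) = (\<integral>\<^sup>+y. 1 \<partial>mu_C n)"
    by simp
  also have "\<dots> = ennreal (sqrt (real n + 1)) * emeasure (lborel_pow n) (B_set n)"
    using sets_B_set[of n] by (subst nn_integral_mu_C[OF n]) (simp_all add: nn_integral_cmult_indicator)
  also have "\<dots> < \<infinity>"
    using B by (auto simp: ennreal_mult_less_top intro: le_less_trans)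
  finally show "emeasure (mu_C n) (space (mu_C n)) \<noteq> \<infinity>"
    by simp
qed

theorem proposition3p2:
  fixes n :: nat and \<alpha> \<beta> :: "nat \<Rightarrow> real" and g :: "(nat \<Rightarrow> real) \<Rightarrow> real"
  assumes "1 \<le> n"
    and "\<And>i. i \<in> {1..n+1} \<Longrightarrow> 0 < \<alpha> i"
    and "\<And>i. i \<in> {1..n+1} \<Longrightarrow> 0 < \<beta> i"
    and "\<And>x. x \<in> B_set n \<Longrightarrow>
      (g \<circ> C_map n) x =
        1 / sqrt (real n + 1) * (D_fun n \<alpha> x / multi_Beta n \<alpha>) *
        ((\<Prod>i=1..n+1. \<beta> i powr \<alpha> i) /
         ((\<Sum>i=1..n. \<beta> i * x i) + \<beta> (n+1) * (1 - (\<Sum>i=1..n. x i)))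
           powr (\<Sum>i=1..n+1. \<alpha> i))"
  shows "absolutely_continuous (mu_C n) (distr (multi_Gamma n \<alpha> \<beta>) (C_borel n) (H_map n))
    \<and> g \<in> borel_measurable (mu_C n)
    \<and> (\<forall>y\<in>C_set n. 0 \<le> g y)
    \<and> distr (multi_Gamma n \<alpha> \<beta>) (C_borel n) (H_map n) = density (mu_C n) (\<lambda>y. ennreal (g y))
    \<and> (AE y in mu_C n.
         RN_deriv (mu_C n) (distr (multi_Gamma n \<alpha> \<beta>) (C_borel n) (H_map n)) y = ennreal (g y))"
proof -
  note n = assms(1) and \<alpha> = assms(2) and \<beta> = assms(3)
  let ?N = "distr (multi_Gamma n \<alpha> \<beta>) (C_borel n) (H_map n)"
  let ?r = "sqrt (real n + 1)"
  have r: "0 < ?r"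
    by simp
  have Beta: "multi_Beta n \<alpha> = (\<Prod>i=1..n+1. Gamma (\<alpha> i)) / Gamma (\<Sum>i=1..n+1. \<alpha> i)"
    using \<alpha> by (rule multi_Beta_eq)
  have g_C_map: "g (C_map n x) = 1 / ?r * cone_density n \<alpha> \<beta> (C_map n x)" if "x \<in> B_set n" for x
    using assms(4)[OF that] unfolding o_def linear_form_C_map Beta
    by (simp only: cone_density_def D_fun_eq_prod_C_map) (simp add: mult_ac)
  \<comment> \<open>The hypothesis prescribes \<open>g\<close> on the image of \<open>B_set n\<close> only, which is all of \<open>C_set n\<close>.\<close>
  have g_eq: "g y = 1 / ?r * cone_density n \<alpha> \<beta> y" if y: "y \<in> C_set n" for y
  proof -
    obtain x where "x \<in> B_set n" "y = C_map n x"
      using y bij_betw_imp_surj_on[OF bij_betw_C_map[OF n]] by blast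
    then show ?thesis
      using g_C_map by simp
  qed
  have nonneg: "0 \<le> cone_density n \<alpha> \<beta> y" for y
    unfolding cone_density_def
    using \<alpha>
    by (intro mult_nonneg_nonneg divide_nonneg_nonneg prod_nonneg less_imp_le[OF Gamma_real_pos] sum_pos)
      (auto intro: Gamma_real_nonneg less_imp_le)
  have "(\<lambda>y. 1 / ?r * cone_density n \<alpha> \<beta> y) \<in> borel_measurable (C_borel n)"
    unfolding cone_density_def C_borel_def by (intro measurable_restrict_space1) measurable
  then have g_C_borel: "g \<in> borel_measurable (C_borel n)"
    by (rule measurable_cong[THEN iffD2, rotated])
      (use g_eq space_mu_C[of n] in \<open>simp add: mu_C_def\<close>)
  then have g_meas: "g \<in> borel_measurable (mu_C n)"
    by (simp add: measurable_cong_sets[OF sets_mu_C refl])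
  have g_nonneg: "\<forall>y\<in>C_set n. 0 \<le> g y"
    using g_eq nonneg r by simp
  have dens: "?N = density (mu_C n) (\<lambda>y. ennreal (g y))"
  proof (rule measure_eqI)
    fix E assume "E \<in> sets ?N"
    then have E: "E \<in> sets (C_borel n)"
      by simp
    have "emeasure (density (mu_C n) (\<lambda>y. ennreal (g y))) E =
        (\<integral>\<^sup>+y. ennreal (g y) * indicator E y \<partial>mu_C n)"
      using g_meas E by (intro emeasure_density) (auto simp: sets_mu_C)
    also have "\<dots> = (\<integral>\<^sup>+x\<in>B_set n. ennreal ?r * (ennreal (g (C_map n x)) * indicator E (C_map n x))
        \<partial>lborel_pow n)"
      using g_C_borel E
      by (intro nn_integral_mu_C[OF n] borel_measurable_times_ennreal borel_measurable_indicator
        measurable_compose[OF _ measurable_ennreal])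
    also have "\<dots> = (\<integral>\<^sup>+x\<in>B_set n. ennreal (cone_density n \<alpha> \<beta> (C_map n x)) * indicator E (C_map n x)
        \<partial>lborel_pow n)"
    proof (intro nn_integral_cong)
      fix x
      have "ennreal ?r * ennreal (g (C_map n x)) = ennreal (cone_density n \<alpha> \<beta> (C_map n x))"
        if "x \<in> B_set n"
        using g_C_map[OF that] by (simp flip: ennreal_mult')
      then show "ennreal ?r * (ennreal (g (C_map n x)) * indicator E (C_map n x)) * indicator (B_set n) x =
          ennreal (cone_density n \<alpha> \<beta> (C_map n x)) * indicator E (C_map n x) * indicator (B_set n) x"
        by (cases "x \<in> B_set n") (simp_all flip: mult.assoc)
    qed
    also have "\<dots> = emeasure ?N E"
      using emeasure_distr_multi_Gamma[OF n \<alpha> \<beta> E] by simp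
    finally show "emeasure ?N E = emeasure (density (mu_C n) (\<lambda>y. ennreal (g y))) E"
      by simp
  qed (simp add: sets_mu_C)
  interpret finite_measure "mu_C n"
    by (rule finite_measure_mu_C[OF n])
  have "AE y in mu_C n. ennreal (g y) = RN_deriv (mu_C n) ?N y"
    using g_meas dens by (intro RN_deriv_unique) auto
  then have RN: "AE y in mu_C n. RN_deriv (mu_C n) ?N y = ennreal (g y)"
    by (rule eventually_mono) (rule sym)
  have "absolutely_continuous (mu_C n) ?N"
    unfolding dens using g_meas by (intro absolutely_continuousI_density) auto
  with g_meas g_nonneg dens RN show ?thesis
    by blast
qed

end
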